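(* Let $M$ be an equicardinal set system on $[n]$. Then $M$ is a matroid if and only if - it has no peerless antipode in any $(2,4)$-hypersimplex, and - it has no isolated antipode in any $(k,2k)$-hypersimplex for $k>2$.
   Context: A set system on $[n]=\{1,\dots,n\}$ is a (possibly empty) collection of subsets of $[n]$; it is equicardinal if all its members have the same cardinality. A set system $M$ is a matroid (given by its bases) if for all $A,B\in M$ and $a\in A\setminus B$ there exists $b\in B\setminus A$ such that $(A\setminus\{a\})\cup\{b\}\in M$ (no nonemptiness is required here). For $S\subseteq[n]$ let $\varepsilon_S\in\mathbb R^n$ be its indicator vector; $\triangle$ is symmetric difference. For $I,J\subseteq[n]$ with $|I|=|J|$, let $\mathcal H_{I,J}=\operatorname{conv}\{\varepsilon_S: |S|=|I|,\ I\cap J\subseteq S\subseteq I\cup J\}$; it is called a $(k,2k)$-hypersimplex when $|I\triangle J|=2k$. For an equicardinal set system $M$ and $I,J\in M$: $(I,J)$ is a peerless antipode of $M$ in $\mathcal H_{I,J}$ if whenever $S,T\in M$ satisfy $S\cap T=I\cap J$ and $S\triangle T=I\triangle J$, then $\{S,T\}=\{I,J\}$; $(I,J)$ is an isolated antipode of $M$ in $\mathcal H_{I,J}$ if whenever $S\in M$ satisfies $I\cap J\subseteq S\subseteq I\cup J$, then $S=I$ or $S=J$. "$M$ has a peerless (isolated) antipode in a $(k,2k)$-hypersimplex" means there are $I,J\in M$ with $|I\triangle J|=2k$ such that $(I,J)$ is a peerless (isolated) antipode of $M$ in $\mathcal H_{I,J}$. *)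

theory Defs
  imports Main
begin

definition set_system :: "nat \<Rightarrow> nat set set \<Rightarrow> bool" where
  "set_system n M \<longleftrightarrow> M \<subseteq> Pow {1..n}"

definition equicardinal :: "nat set set \<Rightarrow> bool" where
  "equicardinal M \<longleftrightarrow> (\<forall>A\<in>M. \<forall>B\<in>M. card A = card B)"

text \<open>A matroid is given by its set of bases; the empty set system is allowed.\<close>

definition matroid :: "nat set set \<Rightarrow> bool" where
  "matroid M \<longleftrightarrow>
    (\<forall>A\<in>M. \<forall>B\<in>M. \<forall>a\<in>A - B. \<exists>b\<in>B - A. (A - {a}) \<union> {b} \<in> M)"

text \<open>
  For sets \<open>I\<close>, \<open>J\<close> of equal cardinality, the hypersimplex \<open>H I J\<close> is the convex hull of the
  indicator vectors of the sets \<open>S\<close> with \<open>card S = card I\<close> and \<open>I \<inter> J \<subseteq> S \<subseteq> I \<union> J\<close>.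
  Being an antipode of \<open>M\<close> in \<open>H I J\<close> is a condition on the members of \<open>M\<close> only, and \<open>H I J\<close> is
  determined by the pair \<open>(I, J)\<close>, so the polytope is not an argument of the predicates below.
  It is a \<open>(k, 2k)\<close>-hypersimplex when \<open>card (I \<triangle> J) = 2 * k\<close>. The predicates are meant for
  equicardinal \<open>M\<close>, where the condition \<open>card S = card I\<close> on members \<open>S\<close> of \<open>M\<close> is automatic.
\<close>

definition peerless_antipode :: "nat set set \<Rightarrow> nat set \<Rightarrow> nat set \<Rightarrow> bool" where
  "peerless_antipode M I J \<longleftrightarrow>
    I \<in> M \<and> J \<in> M \<and>
    (\<forall>S\<in>M. \<forall>T\<in>M. S \<inter> T = I \<inter> J \<and> sym_diff S T = sym_diff I J \<longrightarrow> {S, T} = {I, J})"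

definition isolated_antipode :: "nat set set \<Rightarrow> nat set \<Rightarrow> nat set \<Rightarrow> bool" where
  "isolated_antipode M I J \<longleftrightarrow>
    I \<in> M \<and> J \<in> M \<and>
    (\<forall>S\<in>M. I \<inter> J \<subseteq> S \<and> S \<subseteq> I \<union> J \<longrightarrow> S = I \<or> S = J)"

definition has_peerless_antipode :: "nat set set \<Rightarrow> nat \<Rightarrow> bool" where
  "has_peerless_antipode M k \<longleftrightarrow>
    (\<exists>I\<in>M. \<exists>J\<in>M. card (sym_diff I J) = 2 * k \<and> peerless_antipode M I J)"

definition has_isolated_antipode :: "nat set set \<Rightarrow> nat \<Rightarrow> bool" where
  "has_isolated_antipode M k \<longleftrightarrow>
    (\<exists>I\<in>M. \<exists>J\<in>M. card (sym_diff I J) = 2 * k \<and> isolated_antipode M I J)"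

end

theory Submission
  imports Defs
begin

text \<open>
  Write \<open>d(A, B) = |A - B|\<close>. An isolated antipode is peerless, so the two conditions
  exclude isolated antipodes for all \<open>k \<ge> 2\<close>. Hence two members at distance at least 2 have a
  third one on a geodesic between them, and by induction \<open>A\<close> has a neighbour \<open>A - x + y\<close> in \<open>M\<close> one step closer to \<open>B\<close>.
  To exchange \<open>a\<close> in \<open>A\<close> with \<open>d(A, B) > 2\<close>, exchange it inductively in \<open>A - x + y\<close>, which gives
  \<open>A - x - a + y + z\<close> in \<open>M\<close>; this set has distance 2 from \<open>A\<close>, and at distance 2 the
  exchange property follows from the absence of peerless antipodes.
\<close>

lemma equicardinalD: "equicardinal M \<Longrightarrow> A \<in> M \<Longrightarrow> B \<in> M \<Longrightarrow> card A = card B"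
  unfolding equicardinal_def by blast

lemma card_Diff_eq:
  assumes "finite A" "finite B" "card A = card B"
  shows "card (A - B) = card (B - A)"
  using assms by (metis card_Diff_subset_Int finite_Int inf_commute)

text \<open>Identifies the parameter \<open>k\<close> of a hypersimplex with the distance
  \<open>card (I - J)\<close>.\<close>

lemma card_sym_diff_eq:
  assumes "finite A" "finite B" "card A = card B"
  shows "card (sym_diff A B) = 2 * card (A - B)"
proof -
  have "card (sym_diff A B) = card (A - B) + card (B - A)"
    using assms by (intro card_Un_disjoint) auto
  then show ?thesis using card_Diff_eq[OF assms] by simp
qed

text \<open>Strictness comes from equal cardinality: \<open>S\<close> has an element outside
  \<open>B\<close>, which must then lie in \<open>A\<close>. This makes \<open>card (A - S)\<close>
  a decreasing measure when \<open>B\<close> is replaced by \<open>S\<close>.\<close>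

lemma interval_Diff_psubset:
  assumes "finite S" "finite B" "card S = card B"
    and "A \<inter> B \<subseteq> S" "S \<subseteq> A \<union> B" "S \<noteq> B"
  shows "A - S \<subset> A - B"
proof -
  have "\<not> S \<subseteq> B"
    using assms card_subset_eq by metis
  then show ?thesis using assms(4,5) by blast
qed

lemma single_exchange_eq:
  assumes "finite A" "finite S" "card A = card S" "A - S = {a}"
  obtains b where "S - A = {b}" "S = A - {a} \<union> {b}"
proof -
  have "card (S - A) = 1"
    using card_Diff_eq[OF assms(1-3)] assms(4) by simp
  then obtain b where "S - A = {b}" by (auto simp: card_1_singleton_iff)
  moreover from this assms(4) have "S = A - {a} \<union> {b}" by blast
  ultimately show thesis by (rule that)
qed

lemma matroid_no_isolated_antipode:
  assumes "matroid M" "k \<ge> 2"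
    and fin: "\<And>A. A \<in> M \<Longrightarrow> finite A" and eq: "equicardinal M"
  shows "\<not> has_isolated_antipode M k"
proof
  assume "has_isolated_antipode M k"
  then obtain I J where IJ: "I \<in> M" "J \<in> M" "card (sym_diff I J) = 2 * k"
    and iso: "isolated_antipode M I J"
    unfolding has_isolated_antipode_def by blast
  have k: "card (I - J) = k"
    using card_sym_diff_eq[of I J] equicardinalD[OF eq, of I J] IJ fin by simp
  then have "I - J \<noteq> {}" using assms(2) by force
  then obtain a where a: "a \<in> I - J" by blast
  then obtain b where b: "b \<in> J - I" "I - {a} \<union> {b} \<in> M"
    using assms(1) IJ unfolding matroid_def by blast
  \<comment> \<open>A single exchange towards \<open>J\<close> stays in the interval of the pair, so
    isolation leaves only \<open>J\<close> itself. That would put \<open>I\<close> and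
    \<open>J\<close> at distance 1, contradicting \<open>k \<ge> 2\<close>.\<close>
  have "I - {a} \<union> {b} = J"
  proof -
    have "I \<inter> J \<subseteq> I - {a} \<union> {b}" "I - {a} \<union> {b} \<subseteq> I \<union> J" "I - {a} \<union> {b} \<noteq> I"
      using a b(1) by auto
    then show ?thesis using iso b(2) unfolding isolated_antipode_def by metis
  qed
  then have "I - J \<subseteq> {a}" by auto
  then have "card (I - J) \<le> 1" using card_mono[of "{a}" "I - J"] by simp
  then show False using k assms(2) by simp
qed

text \<open>Besides \<open>I\<close> and \<open>J\<close>, the octahedron has four vertices
  \<open>K \<union> {p, q}\<close> with \<open>p\<close> from \<open>I - J\<close> and
  \<open>q\<close> from \<open>J - I\<close>. They form a 4-cycle whose two opposite pairs are the
  rival antipodes; exchange puts an endpoint of every edge into \<open>M\<close>.\<close>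

lemma matroid_no_peerless_antipode:
  assumes "matroid M"
    and fin: "\<And>A. A \<in> M \<Longrightarrow> finite A" and eq: "equicardinal M"
  shows "\<not> has_peerless_antipode M 2"
proof
  assume "has_peerless_antipode M 2"
  then obtain I J where IJ: "I \<in> M" "J \<in> M" "card (sym_diff I J) = 2 * 2"
    and IJ_peer: "peerless_antipode M I J"
    unfolding has_peerless_antipode_def by blast
  have peer: "S = I \<or> S = J"
    if "S \<in> M" "T \<in> M" "S \<inter> T = I \<inter> J" "sym_diff S T = sym_diff I J" for S T
  proof -
    have "{S, T} = {I, J}" using IJ_peer that unfolding peerless_antipode_def by metis
    then show ?thesis by (auto simp: doubleton_eq_iff)
  qed
  have ex: "\<And>A B a. A \<in> M \<Longrightarrow> B \<in> M \<Longrightarrow> a \<in> A - B \<Longrightarrow> \<exists>b\<in>B - A. A - {a} \<union> {b} \<in> M"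
    using assms(1) unfolding matroid_def by blast
  have c: "card I = card J" "finite I" "finite J"
    using IJ fin equicardinalD[OF eq] by blast+
  then have "card (I - J) = 2" "card (J - I) = 2"
    using card_sym_diff_eq[of I J] card_Diff_eq[of I J] IJ by auto
  then obtain a b c d where ab: "I - J = {a, b}" "a \<noteq> b" and cd: "J - I = {c, d}" "c \<noteq> d"
    unfolding card_2_iff by blast
  define K where "K = I \<inter> J"
  have nK: "a \<notin> K" "b \<notin> K" "c \<notin> K" "d \<notin> K"
    and ne: "a \<noteq> c" "a \<noteq> d" "b \<noteq> c" "b \<noteq> d"
    using ab cd unfolding K_def by blast+
  have I: "I = K \<union> {a, b}" and J: "J = K \<union> {c, d}"
    using ab cd unfolding K_def by blast+
  let ?P = "\<lambda>p q. K \<union> {p, q}"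
  have "\<not> (?P a c \<in> M \<and> ?P b d \<in> M)"
  proof
    assume *: "?P a c \<in> M \<and> ?P b d \<in> M"
    have "?P a c \<inter> ?P b d = I \<inter> J" "sym_diff (?P a c) (?P b d) = sym_diff I J"
      using ab(2) cd(2) ne nK unfolding I J by auto
    with * have "?P a c = I \<or> ?P a c = J" by (intro peer) auto
    \<comment> \<open>The element \<open>a\<close> tells this vertex apart from \<open>J\<close>,
      and \<open>c\<close> tells it apart from \<open>I\<close>.\<close>
    moreover have "a \<in> ?P a c - J" "c \<in> ?P a c - I" using ne nK ab(2) cd(2) unfolding I J by auto
    ultimately show False by (metis DiffD1 DiffD2)
  qed
  moreover have "\<not> (?P a d \<in> M \<and> ?P b c \<in> M)"
  proof
    assume *: "?P a d \<in> M \<and> ?P b c \<in> M"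
    have "?P a d \<inter> ?P b c = I \<inter> J" "sym_diff (?P a d) (?P b c) = sym_diff I J"
      using ab(2) cd(2) ne nK unfolding I J by auto
    with * have "?P a d = I \<or> ?P a d = J" by (intro peer) auto
    moreover have "a \<in> ?P a d - J" "d \<in> ?P a d - I" using ne nK ab(2) cd(2) unfolding I J by auto
    ultimately show False by (metis DiffD1 DiffD2)
  qed
  moreover have "?P b c \<in> M \<or> ?P b d \<in> M"
  proof -
    have "I - {a} = K \<union> {b}" using I nK ab(2) by blast
    moreover have "\<exists>y\<in>{c, d}. I - {a} \<union> {y} \<in> M"
      using ex[OF IJ(1) IJ(2), of a] unfolding ab cd by simp
    ultimately show ?thesis by (simp add: insert_commute)
  qed
  moreover have "?P a c \<in> M \<or> ?P a d \<in> M"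
  proof -
    have "I - {b} = K \<union> {a}" using I nK ab(2) by blast
    moreover have "\<exists>y\<in>{c, d}. I - {b} \<union> {y} \<in> M"
      using ex[OF IJ(1) IJ(2), of b] unfolding ab cd by simp
    ultimately show ?thesis by (simp add: insert_commute)
  qed
  moreover have "?P a d \<in> M \<or> ?P b d \<in> M"
  proof -
    have "J - {c} = K \<union> {d}" using J nK cd(2) by blast
    moreover have "\<exists>y\<in>{a, b}. J - {c} \<union> {y} \<in> M"
      using ex[OF IJ(2) IJ(1), of c] unfolding ab cd by simp
    ultimately show ?thesis by (simp add: insert_commute)
  qed
  moreover have "?P a c \<in> M \<or> ?P b c \<in> M"
  proof -
    have "J - {d} = K \<union> {c}" using J nK cd(2) by blast
    moreover have "\<exists>y\<in>{a, b}. J - {d} \<union> {y} \<in> M"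
      using ex[OF IJ(2) IJ(1), of d] unfolding ab cd by simp
    ultimately show ?thesis by (simp add: insert_commute)
  qed
  \<comment> \<open>A vertex cover of a 4-cycle contains two opposite vertices, but both opposite
    pairs were excluded.\<close>
  ultimately show False by blast
qed

text \<open>A rival pair \<open>S\<close>, \<open>T\<close> meets exactly in
  \<open>A \<inter> B\<close>, so one of the two avoids \<open>a\<close>. That set is a vertex other
  than \<open>A\<close> and \<open>B\<close>, hence at distance 1 from \<open>A\<close>, and it is
  the required exchange.\<close>

lemma no_peerless_antipode_exchange:
  assumes fin: "\<And>A. A \<in> M \<Longrightarrow> finite A" and eq: "equicardinal M"
    and peer: "\<not> has_peerless_antipode M 2"
    and AB: "A \<in> M" "B \<in> M" "card (A - B) = 2" and a: "a \<in> A - B"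
  shows "\<exists>b\<in>B - A. A - {a} \<union> {b} \<in> M"
proof -
  have "card (sym_diff A B) = 2 * 2"
    using card_sym_diff_eq[of A B] equicardinalD[OF eq, of A B] AB fin by simp
  then have "\<not> peerless_antipode M A B"
    using peer AB unfolding has_peerless_antipode_def by blast
  then obtain S T where ST: "S \<in> M" "T \<in> M" "S \<inter> T = A \<inter> B"
      "sym_diff S T = sym_diff A B" "{S, T} \<noteq> {A, B}"
    using AB(1,2) unfolding peerless_antipode_def by metis
  have "\<exists>S\<in>M. A \<inter> B \<subseteq> S \<and> S \<subseteq> A \<union> B \<and> S \<noteq> B \<and> a \<notin> S"
  proof -
    \<comment> \<open>Intersection and symmetric difference determine each set of the pair from the
      other, so if one were \<open>B\<close>, the other would be \<open>A\<close>.\<close>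
    have "S \<noteq> B"
    proof
      assume "S = B"
      then have "T = A" using ST(3,4) by blast
      then show False using ST(5) \<open>S = B\<close> by (simp add: insert_commute)
    qed
    moreover have "T \<noteq> B"
    proof
      assume "T = B"
      then have "S = A" using ST(3,4) by blast
      then show False using ST(5) \<open>T = B\<close> by simp
    qed
    moreover have "a \<notin> S \<or> a \<notin> T" using a ST(3) by blast
    moreover have "A \<inter> B \<subseteq> S" "A \<inter> B \<subseteq> T" "S \<subseteq> A \<union> B" "T \<subseteq> A \<union> B"
      using ST(3,4) by blast+
    ultimately show ?thesis using ST(1,2) by metis
  qed
  then obtain S where S: "S \<in> M" "A \<inter> B \<subseteq> S" "S \<subseteq> A \<union> B" "S \<noteq> B" "a \<notin> S" by blast
  have sub: "A - S \<subset> A - B"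
    using interval_Diff_psubset[of S B A] equicardinalD[OF eq, of S B] S AB fin by blast
  \<comment> \<open>The strict inclusion bounds the distance by 1, and \<open>a\<close> keeps it
    positive; so \<open>a\<close> is the only element removed.\<close>
  have "card (A - S) < 2"
    using psubset_card_mono[OF _ sub] fin AB by simp
  moreover have aS: "a \<in> A - S" using a S(5) by blast
  then have "card (A - S) > 0" using fin AB(1) card_gt_0_iff by blast
  ultimately have "card (A - S) = 1" by linarith
  then have "A - S = {a}" using aS by (metis card_1_singletonE singletonD)
  then obtain b where b: "S - A = {b}" "S = A - {a} \<union> {b}"
    using single_exchange_eq[of A S a] equicardinalD[OF eq, of A S] S AB fin by metis
  have "b \<in> B - A" using b(1) S(3) by blast
  moreover have "A - {a} \<union> {b} \<in> M" using S(1) b(2) by simp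
  ultimately show ?thesis by blast
qed

lemma no_isolated_antipode_neighbour:
  assumes fin: "\<And>A. A \<in> M \<Longrightarrow> finite A" and eq: "equicardinal M"
    and iso: "\<And>k. k \<ge> 2 \<Longrightarrow> \<not> has_isolated_antipode M k"
    and "A \<in> M" "B \<in> M" "A \<noteq> B"
  shows "\<exists>x\<in>A - B. \<exists>y\<in>B - A. A - {x} \<union> {y} \<in> M"
  using assms(4-)
\<comment> \<open>\<open>A\<close> stays fixed while the target \<open>B\<close> is pulled towards
  it; at distance 1 the target is itself the neighbour.\<close>
proof (induction "card (A - B)" arbitrary: B rule: less_induct)
  case less
  have cAB: "card A = card B" "finite A" "finite B"
    using less.prems fin equicardinalD[OF eq] by blast+
  have "A - B \<noteq> {}"
    using less.prems cAB card_subset_eq[of B A] by auto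
  then have "card (A - B) \<noteq> 0" using cAB by simp
  then consider "card (A - B) = 1" | "card (A - B) \<ge> 2" by linarith
  then show ?case
  proof cases
    case 1
    then obtain x where x: "A - B = {x}" by (auto simp: card_1_singleton_iff)
    then obtain y where "B - A = {y}" "B = A - {x} \<union> {y}"
      using single_exchange_eq[of A B x] cAB by metis
    then show ?thesis using x less.prems by force
  next
    case 2
    have "card (sym_diff A B) = 2 * card (A - B)"
      using card_sym_diff_eq cAB by metis
    then obtain S where S: "S \<in> M" "A \<inter> B \<subseteq> S" "S \<subseteq> A \<union> B" "S \<noteq> A" "S \<noteq> B"
      using iso[OF 2] less.prems unfolding has_isolated_antipode_def isolated_antipode_def
      by metis
    have sub: "A - S \<subset> A - B"
      using interval_Diff_psubset[of S B A] equicardinalD[OF eq, of S B] S less.prems fin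
      by blast
    then have "card (A - S) < card (A - B)"
      using cAB by (intro psubset_card_mono) auto
    then obtain x y where "x \<in> A - S" "y \<in> S - A" "A - {x} \<union> {y} \<in> M"
      using less.hyps[of S] S less.prems by blast
    \<comment> \<open>An exchange towards \<open>S\<close> is also one towards \<open>B\<close>,
      because \<open>S\<close> lies between \<open>A\<close> and \<open>B\<close>.\<close>
    moreover from this have "x \<in> A - B" "y \<in> B - A" using S sub by blast+
    ultimately show ?thesis by blast
  qed
qed

lemma matroidI_antipodes:
  assumes fin: "\<And>A. A \<in> M \<Longrightarrow> finite A" and eq: "equicardinal M"
    and peer: "\<not> has_peerless_antipode M 2"
    and iso: "\<And>k. k \<ge> 2 \<Longrightarrow> \<not> has_isolated_antipode M k"
  shows "matroid M"
proof -
  have "\<exists>b\<in>B - A. A - {a} \<union> {b} \<in> M" if "A \<in> M" "B \<in> M" "a \<in> A - B" for A B a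
    using that
  \<comment> \<open>Here the target \<open>B\<close> is fixed and \<open>A\<close> moves, since the
    neighbour of \<open>A\<close> is closer to \<open>B\<close>.\<close>
  proof (induction "card (A - B)" arbitrary: A rule: less_induct)
    case less
    have fA: "finite A" using less.prems fin by blast
    have "A \<noteq> B" using less.prems by blast
    then obtain x y where xy: "x \<in> A - B" "y \<in> B - A" "A - {x} \<union> {y} \<in> M"
      using no_isolated_antipode_neighbour[OF fin eq iso] less.prems by metis
    show ?case
    proof (cases "x = a")
      case True
      then show ?thesis using xy by blast
    next
      case False
      let ?A = "A - {x} \<union> {y}"
      have "card (?A - B) < card (A - B)"
        using fA xy by (intro psubset_card_mono) auto
      then obtain z where z: "z \<in> B - ?A" "?A - {a} \<union> {z} \<in> M"
        using less.hyps[of ?A] xy less.prems False by blast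
      let ?C = "?A - {a} \<union> {z}"
      \<comment> \<open>The only element of \<open>A\<close> missing from \<open>?A\<close> is
        \<open>x\<close>, which is not in \<open>B\<close>; hence \<open>z\<close> is new to
        \<open>A\<close>, and \<open>y\<close>, \<open>z\<close> both come from
        \<open>B - A\<close>.\<close>
      have C: "A - ?C = {x, a}" "?C - A \<subseteq> B - A"
        using xy z less.prems by auto
      \<comment> \<open>As \<open>x \<noteq> a\<close>, the distance from \<open>A\<close> to
        \<open>?C\<close> is exactly 2.\<close>
      then have "\<exists>b\<in>?C - A. A - {a} \<union> {b} \<in> M"
        using no_peerless_antipode_exchange[OF fin eq peer \<open>A \<in> M\<close> z(2)] False by auto
      then show ?thesis using C(2) by blast
    qed
  qed
  then show ?thesis unfolding matroid_def by blast
qed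

text \<open>Both sets of a rival pair lie in the interval between \<open>I \<inter> J\<close> and
  \<open>I \<union> J\<close>, and either one determines the other.\<close>

lemma isolated_antipode_imp_peerless_antipode:
  assumes "isolated_antipode M I J"
  shows "peerless_antipode M I J"
  unfolding peerless_antipode_def
proof (intro conjI ballI impI)
  show "I \<in> M" "J \<in> M" using assms unfolding isolated_antipode_def by auto
  fix S T assume ST: "S \<in> M" "T \<in> M" "S \<inter> T = I \<inter> J \<and> sym_diff S T = sym_diff I J"
  then have "I \<inter> J \<subseteq> S" "S \<subseteq> I \<union> J" by blast+
  then have "S = I \<or> S = J" using assms ST(1) unfolding isolated_antipode_def by blast
  then show "{S, T} = {I, J}"
  proof
    assume "S = I"
    moreover from this have "T = J" using ST(3) by blast
    ultimately show ?thesis by simp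
  next
    assume "S = J"
    moreover from this have "T = I" using ST(3) by blast
    ultimately show ?thesis by (simp add: insert_commute)
  qed
qed

theorem corollary3p10:
  fixes n :: nat and M :: "nat set set"
  assumes "set_system n M" and "equicardinal M"
  shows "matroid M \<longleftrightarrow>
    \<not> has_peerless_antipode M 2 \<and> (\<forall>k>2. \<not> has_isolated_antipode M k)"
proof -
  have fin: "finite A" if "A \<in> M" for A
    using assms(1) that finite_subset[of A "{1..n}"] unfolding set_system_def by blast
  show ?thesis
  proof
    assume "matroid M"
    then show "\<not> has_peerless_antipode M 2 \<and> (\<forall>k>2. \<not> has_isolated_antipode M k)"
      using matroid_no_peerless_antipode matroid_no_isolated_antipode fin assms(2)
      by (metis less_imp_le)
  next
    assume *: "\<not> has_peerless_antipode M 2 \<and> (\<forall>k>2. \<not> has_isolated_antipode M k)"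
    \<comment> \<open>The induction uses every \<open>k \<ge> 2\<close>; the case
      \<open>k = 2\<close> comes from the peerless condition.\<close>
    then have "\<not> has_isolated_antipode M 2"
      unfolding has_peerless_antipode_def has_isolated_antipode_def
      using isolated_antipode_imp_peerless_antipode by blast
    then have "\<not> has_isolated_antipode M k" if "k \<ge> 2" for k
      using * that by (cases "k = 2") auto
    then show "matroid M" using matroidI_antipodes fin assms(2) * by blast
  qed
qed

end
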